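(* For all integers $n\ge 1$ and $0\le k\le n^2$, the Mahonian number of type $B$ counts the lattice paths from $(0,0)$ to $(n,k)$ taking at most $2j-1$ North steps at level $j$ for each $j\ge 1$; that is, $$i_B(n,k)=|\mathcal{P}^{B}_{n,k}|.$$
   Context: $B_n$ is the hyperoctahedral group: the group of bijections $\pi$ of $\{-n,\ldots,-1,1,\ldots,n\}$ with $\pi(-j)=-\pi(j)$ for all $j\in\{1,\dots,n\}$. Every $\pi\in B_n$ is written uniquely as $\pi(p)=(-1)^{r_p}\sigma_p$ for $1\le p\le n$, with $r_p\in\{0,1\}$ and $\sigma=\sigma_1\cdots\sigma_n$ a permutation of $\{1,\dots,n\}$. For $1\le i\le n$ put $m=n+1-i$ and $inv_i(\sigma)=|\{j: j<m,\ \sigma_j>\sigma_m\}|$, and define $inv_i(\pi)=inv_i(\sigma)$ if $r_m=0$, and $inv_i(\pi)=1+2|\{j: j<m,\ \sigma_j<\sigma_m\}|+inv_i(\sigma)$ if $r_m=1$. The number of inversions of type $B$ of $\pi$ is $inv_B(\pi)=\sum_{i=1}^n inv_i(\pi)$. The Mahonian number of type $B$ is $i_B(n,k)=|\{\pi\in B_n: inv_B(\pi)=k\}|$. $\mathcal{P}^{B}_{n,k}$ is the set of lattice paths from $(0,0)$ to $(n,k)$ using only North steps $(0,1)$ and East steps $(1,0)$, such that for each $j\in\{1,\dots,n\}$ the number of North steps at level $j$ (i.e. on the vertical line $x=j$) is at most $2j-1$; there are no North steps on the line $x=0$ (the first step is necessarily an East step). *)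

theory Defs
  imports "HOL-Combinatorics.Permutations"
begin

section \<open>The hyperoctahedral group and inversions of type B\<close>

definition signed_range :: "nat \<Rightarrow> int set" where
  "signed_range n = {- int n..int n} - {0}"

text \<open>As usual with \<^const>\<open>permutes\<close>, a bijection of \<^term>\<open>signed_range n\<close> is represented by its
  extension to all integers by the identity, so that each one has exactly one representative.\<close>

definition hyperoctahedral :: "nat \<Rightarrow> (int \<Rightarrow> int) set" where
  "hyperoctahedral n =
     {\<pi>. \<pi> permutes signed_range n \<and> (\<forall>j\<in>{1..int n}. \<pi> (- j) = - \<pi> j)}"

definition sgn_exp :: "(int \<Rightarrow> int) \<Rightarrow> nat \<Rightarrow> nat" where
  "sgn_exp \<pi> p = (if \<pi> (int p) < 0 then 1 else 0)"

definition abs_perm :: "(int \<Rightarrow> int) \<Rightarrow> nat \<Rightarrow> nat" where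
  "abs_perm \<pi> p = nat \<bar>\<pi> (int p)\<bar>"

text \<open>In the next two definitions \<open>i\<close> counts positions from the right: the relevant position is
  \<open>m = n + 1 - i\<close>.\<close>

definition inv_at :: "nat \<Rightarrow> (nat \<Rightarrow> nat) \<Rightarrow> nat \<Rightarrow> nat" where
  "inv_at n \<sigma> i = (let m = n + 1 - i in card {j \<in> {1..<m}. \<sigma> j > \<sigma> m})"

definition inv_B_at :: "nat \<Rightarrow> (int \<Rightarrow> int) \<Rightarrow> nat \<Rightarrow> nat" where
  "inv_B_at n \<pi> i =
     (let m = n + 1 - i; \<sigma> = abs_perm \<pi> in
      if sgn_exp \<pi> m = 0 then inv_at n \<sigma> i
      else 1 + 2 * card {j \<in> {1..<m}. \<sigma> j < \<sigma> m} + inv_at n \<sigma> i)"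

definition inv_B :: "nat \<Rightarrow> (int \<Rightarrow> int) \<Rightarrow> nat" where
  "inv_B n \<pi> = (\<Sum>i = 1..n. inv_B_at n \<pi> i)"

definition mahonian_B :: "nat \<Rightarrow> nat \<Rightarrow> nat" where
  "mahonian_B n k = card {\<pi> \<in> hyperoctahedral n. inv_B n \<pi> = k}"

text \<open>\<^const>\<open>sgn_exp\<close> and \<^const>\<open>abs_perm\<close> are the \<open>r\<close> and \<open>\<sigma>\<close> of the unique decomposition
  \<open>\<pi>(p) = (-1)^r\<^sub>p \<sigma>\<^sub>p\<close>.\<close>

lemma signed_decomposition: "\<pi> (int p) = (- 1) ^ sgn_exp \<pi> p * int (abs_perm \<pi> p)"
  by (simp add: sgn_exp_def abs_perm_def)

lemma abs_perm_bij:
  assumes "\<pi> \<in> hyperoctahedral n"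
  shows "bij_betw (abs_perm \<pi>) {1..n} {1..n}"
proof -
  from assms have perm: "\<pi> permutes signed_range n"
    and odd: "\<And>j. j \<in> {1..int n} \<Longrightarrow> \<pi> (- j) = - \<pi> j"
    by (auto simp: hyperoctahedral_def)
  have inj: "inj_on (abs_perm \<pi>) {1..n}"
  proof (rule inj_onI)
    fix p q assume pq: "p \<in> {1..n}" "q \<in> {1..n}" "abs_perm \<pi> p = abs_perm \<pi> q"
    then have "\<pi> (int p) = \<pi> (int q) \<or> \<pi> (int p) = - \<pi> (int q)"
      by (auto simp: abs_perm_def)
    moreover have "- \<pi> (int q) = \<pi> (- int q)" using odd[of "int q"] pq by auto
    ultimately have "int p = int q \<or> int p = - int q"
      using permutes_inj[OF perm] by (metis injD)
    with pq show "p = q" by auto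
  qed
  have "abs_perm \<pi> ` {1..n} \<subseteq> {1..n}"
  proof
    fix y assume "y \<in> abs_perm \<pi> ` {1..n}"
    then obtain p where p: "p \<in> {1..n}" "y = abs_perm \<pi> p" by auto
    then have "int p \<in> signed_range n" by (auto simp: signed_range_def)
    then have "\<pi> (int p) \<in> signed_range n" using permutes_in_image[OF perm] by blast
    with p show "y \<in> {1..n}" by (auto simp: signed_range_def abs_perm_def)
  qed
  with inj show ?thesis
    by (simp add: bij_betw_def endo_inj_surj)
qed


section \<open>Lattice paths\<close>

datatype lattice_step = North | East

fun endpoint :: "nat \<times> nat \<Rightarrow> lattice_step list \<Rightarrow> nat \<times> nat" where
  "endpoint v [] = v"
| "endpoint (x, y) (North # s) = endpoint (x, y + 1) s"
| "endpoint (x, y) (East # s) = endpoint (x + 1, y) s"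

definition north_steps_at :: "lattice_step list \<Rightarrow> nat \<Rightarrow> nat" where
  "north_steps_at s j =
     card {t. t < length s \<and> s ! t = North \<and> fst (endpoint (0, 0) (take t s)) = j}"

definition lattice_paths_B :: "nat \<Rightarrow> nat \<Rightarrow> lattice_step list set" where
  "lattice_paths_B n k =
     {s. endpoint (0, 0) s = (n, k) \<and> north_steps_at s 0 = 0 \<and>
         (\<forall>j\<in>{1..n}. north_steps_at s j \<le> 2 * j - 1)}"

end

theory Submission
  imports Defs
begin

text \<open>
  Both sides count the functions \<open>c\<close> on \<open>{1..n}\<close> with \<open>c m \<le> 2 * m - 1\<close> for every \<open>m\<close> and with
  total \<open>k\<close>; these are the bounded codes below.

  For paths, \<open>c m\<close> is the number of North steps at level \<open>m\<close>. A path that starts with an East step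
  is \<open>E N\<^bsup>c 1\<^esup> E N\<^bsup>c 2\<^esup> \<dots> E N\<^bsup>c n\<^esup>\<close>, so it is recovered from \<open>c\<close>, and its height is
  the sum of \<open>c\<close> (\<open>lattice_paths_bij_bounded_codes\<close>).

  For signed permutations, \<open>c m\<close> is the contribution of position \<open>m\<close> to \<^const>\<open>inv_B\<close>. Let \<open>g\<close> be
  the number of earlier entries that are larger in absolute value, so \<open>0 \<le> g \<le> m - 1\<close>. A positive
  entry contributes \<open>g\<close>; a negative one contributes \<open>1 + 2 * (m - 1 - g) + g = 2 * m - 1 - g\<close>.
  These values fill \<open>{0..m - 1}\<close> and \<open>{m..2 * m - 1}\<close>, so \<open>c m\<close> encodes both the sign and \<open>g\<close>. The
  numbers \<open>g\<close> form a Lehmer code, which determines the underlying permutation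
  (\<open>eq_if_greater_before_eq\<close>); so the map to codes is injective. There are at least \<open>2 ^ n * n!\<close>
  signed permutations and exactly \<open>2 * 4 * \<dots> * (2 * n) = 2 ^ n * n!\<close> codes, so it is bijective
  (\<open>letter_code_bij\<close>).
\<close>

section \<open>Bounded codes\<close>

definition code_box :: "nat \<Rightarrow> (nat \<Rightarrow> nat) set" where
  "code_box n = (\<Pi>\<^sub>E m\<in>{1..n}. {..2 * m - 1})"

definition bounded_codes :: "nat \<Rightarrow> nat \<Rightarrow> (nat \<Rightarrow> nat) set" where
  "bounded_codes n k = {c \<in> code_box n. sum c {1..n} = k}"

lemma finite_code_box: "finite (code_box n)"
  by (simp add: code_box_def finite_PiE)

lemma card_code_box: "card (code_box n) = 2 ^ n * fact n"
proof -
  have "card (code_box n) = (\<Prod>m = 1..n. Suc (2 * m - 1))"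
    by (simp add: code_box_def card_PiE)
  also have "\<dots> = (\<Prod>m = 1..n. 2 * m)"
    by (intro prod.cong) auto
  also have "\<dots> = 2 ^ n * fact n"
    by (simp add: prod.distrib fact_prod)
  finally show ?thesis .
qed

section \<open>Lattice paths as codes\<close>

text \<open>Paths are extended on the right: appending a step leaves the levels of the earlier steps
  unchanged.\<close>

lemma endpoint_append: "endpoint v (s @ t) = endpoint (endpoint v s) t"
  by (induction v s rule: endpoint.induct) auto

lemma north_steps_at_Nil [simp]: "north_steps_at [] j = 0"
  by (simp add: north_steps_at_def)

lemma north_steps_at_snoc:
  "north_steps_at (s @ [a]) j =
     north_steps_at s j + (if a = North \<and> fst (endpoint (0, 0) s) = j then 1 else 0)"
proof -
  let ?old = "{t. t < length s \<and> s ! t = North \<and> fst (endpoint (0, 0) (take t s)) = j}"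
  let ?new = "if a = North \<and> fst (endpoint (0, 0) s) = j then {length s} else {}"
  have "{t. t < length (s @ [a]) \<and> (s @ [a]) ! t = North \<and>
            fst (endpoint (0, 0) (take t (s @ [a]))) = j} = ?old \<union> ?new"
    by (auto simp: nth_append less_Suc_eq)
  moreover have "card (?old \<union> ?new) = card ?old + card ?new"
    by (intro card_Un_disjoint) auto
  ultimately show ?thesis
    by (simp add: north_steps_at_def)
qed

fun path_of_code :: "(nat \<Rightarrow> nat) \<Rightarrow> nat \<Rightarrow> lattice_step list" where
  "path_of_code c 0 = []"
| "path_of_code c (Suc n) = path_of_code c n @ East # replicate (c (Suc n)) North"

lemma path_of_code_cong:
  "(\<And>m. m \<in> {1..n} \<Longrightarrow> c m = d m) \<Longrightarrow> path_of_code c n = path_of_code d n"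
  by (induction n) auto

lemma endpoint_replicate_North: "endpoint (x, y) (replicate r North) = (x, y + r)"
  by (induction r arbitrary: y) auto

lemma endpoint_path_of_code: "endpoint (0, 0) (path_of_code c n) = (n, sum c {1..n})"
  by (induction n) (auto simp: endpoint_append endpoint_replicate_North)

lemma north_steps_at_append_replicate_North:
  "north_steps_at (s @ replicate r North) j =
     north_steps_at s j + (if fst (endpoint (0, 0) s) = j then r else 0)"
proof (induction r)
  case (Suc r)
  obtain x y where "endpoint (0, 0) s = (x, y)"
    by fastforce
  then have "fst (endpoint (0, 0) (s @ replicate r North)) = fst (endpoint (0, 0) s)"
    by (simp add: endpoint_append endpoint_replicate_North)
  with Suc north_steps_at_snoc[of "s @ replicate r North" North j] show ?case
    by (simp add: replicate_append_same)
qed simp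

lemma north_steps_at_path_of_code:
  "north_steps_at (path_of_code c n) j = (if j \<in> {1..n} then c j else 0)"
proof (induction n)
  case (Suc n)
  have "fst (endpoint (0, 0) (path_of_code c n @ [East])) = Suc n"
    by (simp add: endpoint_append endpoint_path_of_code)
  with north_steps_at_append_replicate_North[of "path_of_code c n @ [East]" "c (Suc n)" j] Suc
  show ?case
    by (auto simp: north_steps_at_snoc)
qed simp

lemma north_steps_at_beyond_endpoint:
  "fst (endpoint (0, 0) s) < j \<Longrightarrow> north_steps_at s j = 0"
proof (induction s rule: rev_induct)
  case (snoc a s)
  then show ?case
    by (cases a; cases "endpoint (0, 0) s") (auto simp: endpoint_append north_steps_at_snoc)
qed simp

text \<open>The North steps at one level are consecutive, so a path is determined by their numbers. Allowing
  an initial block at level 0 makes this true of every word, which lets the induction run over all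
  prefixes.\<close>

lemma path_eq_path_of_code:
  "s = replicate (north_steps_at s 0) North @
       path_of_code (north_steps_at s) (fst (endpoint (0, 0) s))"
proof (induction s rule: rev_induct)
  case (snoc a s)
  obtain x y where xy: "endpoint (0, 0) s = (x, y)"
    by fastforce
  show ?case
  proof (cases a)
    case East
    have "north_steps_at (s @ [a]) = north_steps_at s"
      by (rule ext) (simp add: East north_steps_at_snoc)
    moreover have "north_steps_at s (Suc x) = 0"
      by (rule north_steps_at_beyond_endpoint) (simp add: xy)
    ultimately show ?thesis
      using snoc xy by (simp add: East endpoint_append)
  next
    case North
    let ?d = "north_steps_at (s @ [a])"
    have d: "?d j = (if j = x then Suc (north_steps_at s j) else north_steps_at s j)" for j
      by (simp add: North north_steps_at_snoc xy)
    have end_eq: "fst (endpoint (0, 0) (s @ [a])) = x"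
      by (simp add: North endpoint_append xy)
    show ?thesis
    proof (cases x)
      case 0
      then have "s = replicate (north_steps_at s 0) North"
        using snoc xy by simp
      then have "s @ [North] = replicate (Suc (north_steps_at s 0)) North"
        by (metis replicate_Suc replicate_append_same)
      then show ?thesis
        using d[of 0] by (simp only: end_eq) (simp add: 0 North)
    next
      case (Suc x')
      have "path_of_code ?d x' = path_of_code (north_steps_at s) x'"
        by (rule path_of_code_cong) (simp add: d Suc)
      then have "path_of_code ?d x = path_of_code (north_steps_at s) x @ [North]"
        by (simp add: Suc d replicate_append_same)
      moreover have "?d 0 = north_steps_at s 0"
        by (simp add: d Suc)
      ultimately show ?thesis
        using snoc xy by (simp only: end_eq) (simp add: North)
    qed
  qed
qed simp

lemma lattice_paths_bij_bounded_codes: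
  "bij_betw (\<lambda>s. restrict (north_steps_at s) {1..n}) (lattice_paths_B n k) (bounded_codes n k)"
proof -
  have recover: "path_of_code (restrict (north_steps_at s) {1..n}) n = s"
    if "s \<in> lattice_paths_B n k" for s
  proof -
    have "s = path_of_code (north_steps_at s) n"
      using path_eq_path_of_code[of s] that by (simp add: lattice_paths_B_def)
    also have "\<dots> = path_of_code (restrict (north_steps_at s) {1..n}) n"
      by (rule path_of_code_cong) simp
    finally show ?thesis by simp
  qed
  have code: "restrict (north_steps_at s) {1..n} \<in> bounded_codes n k"
    if s: "s \<in> lattice_paths_B n k" for s
  proof -
    let ?c = "restrict (north_steps_at s) {1..n}"
    have "endpoint (0, 0) s = (n, sum ?c {1..n})"
      using endpoint_path_of_code[of ?c n] recover[OF s] by simp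
    with s show ?thesis
      by (auto simp: bounded_codes_def code_box_def lattice_paths_B_def)
  qed
  have code_of_path: "restrict (north_steps_at (path_of_code c n)) {1..n} = c"
    if "c \<in> bounded_codes n k" for c
    using that
    by (auto simp: bounded_codes_def code_box_def north_steps_at_path_of_code fun_eq_iff
        restrict_def PiE_def extensional_def)
  have path: "path_of_code c n \<in> lattice_paths_B n k" if "c \<in> bounded_codes n k" for c
    using that
    by (auto simp: bounded_codes_def code_box_def lattice_paths_B_def endpoint_path_of_code
        north_steps_at_path_of_code PiE_def Pi_def)
  show ?thesis
    by (rule bij_betw_byWitness[where f' = "\<lambda>c. path_of_code c n"])
      (use recover code code_of_path path in auto)
qed

section \<open>The Lehmer code of a permutation\<close>

definition greater_before :: "(nat \<Rightarrow> nat) \<Rightarrow> nat \<Rightarrow> nat" where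
  "greater_before \<sigma> m = card {j \<in> {1..<m}. \<sigma> j > \<sigma> m}"

lemma greater_before_le: "greater_before \<sigma> m \<le> m - 1"
  unfolding greater_before_def
  by (rule order_trans[OF card_mono[of "{1..<m}"]]) auto

lemma less_before_eq:
  assumes "inj_on \<sigma> {1..n}" and "m \<in> {1..n}"
  shows "card {j \<in> {1..<m}. \<sigma> j < \<sigma> m} = m - 1 - greater_before \<sigma> m"
proof -
  have "\<sigma> j \<noteq> \<sigma> m" if "j \<in> {1..<m}" for j
    using assms that by (auto dest: inj_onD)
  then have "{j \<in> {1..<m}. \<sigma> j < \<sigma> m} = {1..<m} - {j \<in> {1..<m}. \<sigma> j > \<sigma> m}"
    by (auto simp: not_less le_less)
  then show ?thesis
    by (simp add: greater_before_def card_Diff_subset subset_eq)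
qed

text \<open>Read from right to left, the Lehmer code names the entries one at a time: once the entries to the
  right of position \<open>m\<close> are known, so is the set \<open>A\<close> of the remaining ones, and the entry at \<open>m\<close> is the
  element of \<open>A\<close> that has \<^term>\<open>greater_before \<sigma> m\<close> elements of \<open>A\<close> above it.\<close>

lemma eq_if_greater_before_eq:
  assumes \<sigma>: "bij_betw \<sigma> {1..n} {1..n}" and \<tau>: "bij_betw \<tau> {1..n} {1..n}"
    and code: "\<And>m. m \<in> {1..n} \<Longrightarrow> greater_before \<sigma> m = greater_before \<tau> m"
    and m: "m \<in> {1..n}"
  shows "\<sigma> m = \<tau> m"
  using m
proof (induction "n - m" arbitrary: m rule: less_induct)
  case less
  have right: "\<sigma> j = \<tau> j" if "j \<in> {m<..n}" for j
    using less.hyps[of j] less.prems that by auto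
  define A where "A = {1..n} - \<sigma> ` {m<..n}"
  have split: "{1..m} = {1..n} - {m<..n}"
    using less.prems by auto
  have initial: "\<rho> ` {1..m} = {1..n} - \<rho> ` {m<..n}"
    if "bij_betw \<rho> {1..n} {1..n}" for \<rho> :: "nat \<Rightarrow> nat"
    unfolding split using that less.prems
    by (subst inj_on_image_set_diff[of \<rho> "{1..n}"]) (auto simp: bij_betw_def)
  have A: "\<sigma> ` {1..m} = A" "\<tau> ` {1..m} = A"
    using initial[OF \<sigma>] initial[OF \<tau>] image_cong[OF refl right, of "{m<..n}"]
    by (simp_all add: A_def)
  have count: "greater_before \<rho> m = card {a \<in> A. a > \<rho> m}"
    if "bij_betw \<rho> {1..n} {1..n}" "\<rho> ` {1..m} = A" for \<rho> :: "nat \<Rightarrow> nat"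
  proof -
    have "{a \<in> A. a > \<rho> m} = \<rho> ` {j \<in> {1..<m}. \<rho> j > \<rho> m}"
      unfolding that(2)[symmetric] by (auto simp: le_less image_iff)
    moreover have "inj_on \<rho> {j \<in> {1..<m}. \<rho> j > \<rho> m}"
      using that(1) less.prems by (auto simp: bij_betw_def intro: inj_on_subset)
    ultimately show ?thesis
      by (simp add: greater_before_def card_image)
  qed
  have fewer_above: "card {a \<in> A. a > y} < card {a \<in> A. a > x}" if "x < y" "y \<in> A" for x y
    using that by (intro psubset_card_mono) (auto simp: A_def)
  have "\<sigma> m \<in> A" "\<tau> m \<in> A"
    using A less.prems by auto
  moreover have "card {a \<in> A. a > \<sigma> m} = card {a \<in> A. a > \<tau> m}"
    using count[OF \<sigma> A(1)] count[OF \<tau> A(2)] code[OF less.prems] by simp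
  ultimately show ?case
    using fewer_above[of "\<sigma> m" "\<tau> m"] fewer_above[of "\<tau> m" "\<sigma> m"] by
      (cases "\<sigma> m" "\<tau> m" rule: linorder_cases) auto
qed

section \<open>The code of a signed permutation\<close>

definition letter_code :: "(int \<Rightarrow> int) \<Rightarrow> nat \<Rightarrow> nat" where
  "letter_code \<pi> m =
     (if \<pi> (int m) < 0 then 2 * m - 1 - greater_before (abs_perm \<pi>) m
      else greater_before (abs_perm \<pi>) m)"

lemma inv_B_at_eq_letter_code:
  assumes "\<pi> \<in> hyperoctahedral n" and m: "m \<in> {1..n}"
  shows "inv_B_at n \<pi> (n + 1 - m) = letter_code \<pi> m"
proof -
  have "card {j \<in> {1..<m}. abs_perm \<pi> j < abs_perm \<pi> m} = m - 1 - greater_before (abs_perm \<pi>) m"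
    using abs_perm_bij[OF assms(1)] m by (intro less_before_eq) (auto simp: bij_betw_def)
  moreover have "n + 1 - (n + 1 - m) = m"
    using m by auto
  ultimately show ?thesis
    using m greater_before_le[of "abs_perm \<pi>" m]
    unfolding inv_B_at_def inv_at_def letter_code_def Let_def sgn_exp_def
    by (auto simp: greater_before_def)
qed

lemma inv_B_eq_sum_letter_code:
  assumes "\<pi> \<in> hyperoctahedral n"
  shows "inv_B n \<pi> = sum (letter_code \<pi>) {1..n}"
proof -
  have "inv_B n \<pi> = (\<Sum>m = 1..n. inv_B_at n \<pi> (n + 1 - m))"
    unfolding inv_B_def by (rule sum.atLeastAtMost_rev)
  also have "\<dots> = sum (letter_code \<pi>) {1..n}"
    using inv_B_at_eq_letter_code[OF assms] by (intro sum.cong) auto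
  finally show ?thesis .
qed

lemma letter_code_le: "m \<ge> 1 \<Longrightarrow> letter_code \<pi> m \<le> 2 * m - 1"
  using greater_before_le[of "abs_perm \<pi>" m] by (auto simp: letter_code_def)

text \<open>The sign is read off by comparing the code with \<open>m\<close>: positive entries give values below \<open>m\<close>, negative
  ones give values from \<open>m\<close> on.\<close>

lemma letter_code_eqD:
  assumes "letter_code \<pi> m = letter_code \<rho> m" and "m \<ge> 1"
  shows "\<pi> (int m) < 0 \<longleftrightarrow> \<rho> (int m) < 0"
    and "greater_before (abs_perm \<pi>) m = greater_before (abs_perm \<rho>) m"
  using assms greater_before_le[of "abs_perm \<pi>" m] greater_before_le[of "abs_perm \<rho>" m]
  by (auto simp: letter_code_def split: if_splits)

lemma hyperoctahedral_eqI:
  assumes \<pi>: "\<pi> \<in> hyperoctahedral n" and \<rho>: "\<rho> \<in> hyperoctahedral n"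
    and eq: "\<And>p. p \<in> {1..n} \<Longrightarrow> \<pi> (int p) = \<rho> (int p)"
  shows "\<pi> = \<rho>"
proof
  fix x
  have pos: "\<pi> y = \<rho> y" if "y \<in> {1..int n}" for y
    using eq[of "nat y"] that by (simp add: le_nat_iff nat_le_iff)
  have "x \<in> {1..int n} \<or> - x \<in> {1..int n} \<or> x \<notin> signed_range n"
    by (auto simp: signed_range_def)
  then consider "x \<in> {1..int n}" | "- x \<in> {1..int n}" | "x \<notin> signed_range n"
    by blast
  then show "\<pi> x = \<rho> x"
  proof cases
    case 2
    then have "\<pi> (- (- x)) = - \<pi> (- x)" "\<rho> (- (- x)) = - \<rho> (- x)"
      using \<pi> \<rho> unfolding hyperoctahedral_def by blast+
    with pos[OF 2] show ?thesis by simp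
  next
    case 3
    with \<pi> \<rho> show ?thesis
      by (auto simp: hyperoctahedral_def permutes_not_in)
  qed (rule pos)
qed

lemma letter_code_inj_on: "inj_on (\<lambda>\<pi>. restrict (letter_code \<pi>) {1..n}) (hyperoctahedral n)"
proof (rule inj_onI)
  fix \<pi> \<rho>
  assume \<pi>: "\<pi> \<in> hyperoctahedral n" and \<rho>: "\<rho> \<in> hyperoctahedral n"
    and eq: "restrict (letter_code \<pi>) {1..n} = restrict (letter_code \<rho>) {1..n}"
  have code: "letter_code \<pi> m = letter_code \<rho> m" if "m \<in> {1..n}" for m
    using fun_cong[OF eq, of m] that by simp
  show "\<pi> = \<rho>"
  proof (rule hyperoctahedral_eqI[OF \<pi> \<rho>])
    fix p assume p: "p \<in> {1..n}"
    have "abs_perm \<pi> p = abs_perm \<rho> p"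
      using eq_if_greater_before_eq[OF abs_perm_bij[OF \<pi>] abs_perm_bij[OF \<rho>] _ p]
        letter_code_eqD(2)[OF code] by auto
    moreover have "sgn_exp \<pi> p = sgn_exp \<rho> p"
      using letter_code_eqD(1)[OF code[OF p]] p by (simp add: sgn_exp_def)
    ultimately show "\<pi> (int p) = \<rho> (int p)"
      using signed_decomposition[of \<pi> p] signed_decomposition[of \<rho> p] by simp
  qed
qed

section \<open>Counting signed permutations\<close>

text \<open>These maps, one for each choice of a permutation \<open>\<sigma>\<close> and a set \<open>S\<close> of positions with negative
  entry, serve to bound the order of the group from below.\<close>

definition signed_perm :: "nat \<Rightarrow> (nat \<Rightarrow> nat) \<Rightarrow> nat set \<Rightarrow> int \<Rightarrow> int" where
  "signed_perm n \<sigma> S x =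
     (if x \<in> signed_range n
      then (if nat \<bar>x\<bar> \<in> S then -1 else 1) * sgn x * int (\<sigma> (nat \<bar>x\<bar>)) else x)"

lemma nat_abs_signed_range: "x \<in> signed_range n \<Longrightarrow> nat \<bar>x\<bar> \<in> {1..n}"
  by (auto simp: signed_range_def)

lemma signed_perm_in_hyperoctahedral:
  assumes \<sigma>: "\<sigma> permutes {1..n}"
  shows "signed_perm n \<sigma> S \<in> hyperoctahedral n"
proof -
  let ?\<pi> = "signed_perm n \<sigma> S"
  have range: "\<sigma> p \<in> {1..n}" if "p \<in> {1..n}" for p
    using permutes_in_image[OF \<sigma>] that by blast
  have abs_val: "nat \<bar>?\<pi> x\<bar> = \<sigma> (nat \<bar>x\<bar>)" if "x \<in> signed_range n" for x
    using that by (auto simp: signed_perm_def abs_mult signed_range_def)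
  have "inj_on ?\<pi> (signed_range n)"
  proof (rule inj_onI)
    fix x y assume xy: "x \<in> signed_range n" "y \<in> signed_range n" "?\<pi> x = ?\<pi> y"
    then have "\<sigma> (nat \<bar>x\<bar>) = \<sigma> (nat \<bar>y\<bar>)"
      using abs_val by metis
    then have abs_eq: "nat \<bar>x\<bar> = nat \<bar>y\<bar>"
      using permutes_inj[OF \<sigma>] by (simp add: inj_eq)
    have "\<sigma> (nat \<bar>y\<bar>) \<noteq> 0"
      using range[OF nat_abs_signed_range[OF xy(2)]] by auto
    with xy abs_eq have "sgn x = sgn y"
      by (auto simp: signed_perm_def split: if_splits)
    moreover have "\<bar>x\<bar> = \<bar>y\<bar>"
      using abs_eq by simp
    ultimately show "x = y"
      by (metis mult_sgn_abs)
  qed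
  moreover have "?\<pi> ` signed_range n \<subseteq> signed_range n"
  proof (rule image_subsetI)
    fix x assume x: "x \<in> signed_range n"
    have "nat \<bar>?\<pi> x\<bar> \<in> {1..n}"
      using range[OF nat_abs_signed_range[OF x]] abs_val[OF x] by simp
    then show "?\<pi> x \<in> signed_range n"
      by (auto simp: signed_range_def)
  qed
  moreover have "finite (signed_range n)"
    by (simp add: signed_range_def)
  ultimately have "bij_betw ?\<pi> (signed_range n) (signed_range n)"
    by (simp add: bij_betw_def endo_inj_surj)
  then have "?\<pi> permutes signed_range n"
    by (rule bij_imp_permutes) (simp add: signed_perm_def)
  moreover have "?\<pi> (- j) = - ?\<pi> j" if "j \<in> {1..int n}" for j
    using that by (auto simp: signed_perm_def signed_range_def)
  ultimately show ?thesis
    by (simp add: hyperoctahedral_def)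
qed

lemma signed_perm_inj_on:
  "inj_on (\<lambda>(\<sigma>, S). signed_perm n \<sigma> S) ({\<sigma>. \<sigma> permutes {1..n}} \<times> Pow {1..n})"
proof (rule inj_onI, clarify)
  fix \<sigma> S \<tau> T
  assume \<sigma>: "\<sigma> permutes {1..n}" and \<tau>: "\<tau> permutes {1..n}" and S: "S \<subseteq> {1..n}" and T: "T \<subseteq> {1..n}"
    and eq: "signed_perm n \<sigma> S = signed_perm n \<tau> T"
  have entry: "\<sigma> p = \<tau> p \<and> (p \<in> S \<longleftrightarrow> p \<in> T)" if p: "p \<in> {1..n}" for p
  proof -
    have "\<sigma> p \<ge> 1" "\<tau> p \<ge> 1"
      using permutes_in_image[OF \<sigma>, of p] permutes_in_image[OF \<tau>, of p] p by auto
    then show ?thesis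
      using fun_cong[OF eq, of "int p"] p
      by (auto simp: signed_perm_def signed_range_def split: if_splits)
  qed
  have "\<sigma> = \<tau>"
  proof
    fix p show "\<sigma> p = \<tau> p"
      using entry[of p] permutes_not_in[OF \<sigma>, of p] permutes_not_in[OF \<tau>, of p]
      by (cases "p \<in> {1..n}") auto
  qed
  moreover have "S = T"
    using entry S T by blast
  ultimately show "\<sigma> = \<tau> \<and> S = T" by simp
qed

lemma finite_hyperoctahedral: "finite (hyperoctahedral n)"
proof (rule finite_subset)
  show "hyperoctahedral n \<subseteq> {\<pi>. \<pi> permutes signed_range n}"
    by (auto simp: hyperoctahedral_def)
  show "finite {\<pi>. \<pi> permutes signed_range n}"
    by (rule finite_permutations) (simp add: signed_range_def)
qed

lemma card_hyperoctahedral_ge: "2 ^ n * fact n \<le> card (hyperoctahedral n)"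
proof -
  let ?D = "{\<sigma>. \<sigma> permutes {1..n}} \<times> Pow {1..n}"
  have "card ?D = 2 ^ n * fact n"
    by (simp add: card_cartesian_product card_permutations[OF refl] card_Pow)
  moreover have "card ?D \<le> card (hyperoctahedral n)"
    by (rule card_inj_on_le[OF signed_perm_inj_on])
      (auto intro: signed_perm_in_hyperoctahedral finite_hyperoctahedral)
  ultimately show ?thesis by simp
qed

text \<open>An injection into the code box, which is no larger than the group, is onto.\<close>

lemma letter_code_bij:
  "bij_betw (\<lambda>\<pi>. restrict (letter_code \<pi>) {1..n}) (hyperoctahedral n) (code_box n)"
proof -
  let ?code = "\<lambda>\<pi>. restrict (letter_code \<pi>) {1..n}"
  have "?code ` hyperoctahedral n \<subseteq> code_box n"
    by (auto simp: code_box_def letter_code_le simp del: One_nat_def)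
  moreover have "card (code_box n) \<le> card (?code ` hyperoctahedral n)"
    unfolding card_image[OF letter_code_inj_on] card_code_box by (rule card_hyperoctahedral_ge)
  ultimately have "?code ` hyperoctahedral n = code_box n"
    by (intro card_seteq finite_code_box)
  with letter_code_inj_on show ?thesis
    by (simp add: bij_betw_def)
qed

lemma mahonian_B_eq_card_bounded_codes: "mahonian_B n k = card (bounded_codes n k)"
proof -
  let ?code = "\<lambda>\<pi>. restrict (letter_code \<pi>) {1..n}"
  have "bij_betw ?code {\<pi> \<in> hyperoctahedral n. inv_B n \<pi> = k} (bounded_codes n k)"
    unfolding bounded_codes_def
  proof (rule bij_betw_Collect[OF letter_code_bij])
    fix \<pi> assume "\<pi> \<in> hyperoctahedral n"
    then show "(sum (?code \<pi>) {1..n} = k) = (inv_B n \<pi> = k)"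
      by (simp add: inv_B_eq_sum_letter_code)
  qed
  then show ?thesis
    unfolding mahonian_B_def by (rule bij_betw_same_card)
qed

theorem theorem3p11:
  fixes n k :: nat
  assumes "n \<ge> 1" and "k \<le> n\<^sup>2"
  shows "mahonian_B n k = card (lattice_paths_B n k)"
  unfolding mahonian_B_eq_card_bounded_codes
  by (rule bij_betw_same_card[OF lattice_paths_bij_bounded_codes, symmetric])

end
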